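(* Let $G_1$ and $G_2$ be two arbitrary graphs, each with at least two vertices, each of which may or may not be asymmetric, with $G_1$ connected, $|V(G_1)|=m$ and $|V(G_2)|=n$. Then $fix(G_1\odot G_2)= \max\{fix(G_1),\, m\, fix(G_2)\}$.
   Context: All graphs are finite and simple. A graph is asymmetric if its automorphism group consists only of the identity. For a graph $G$, a set $\mathcal{F}\subseteq V(G)$ is a fixing set of $G$ if the only automorphism of $G$ that fixes every vertex of $\mathcal{F}$ is the identity. The fixing number $fix(G)$ is the minimum cardinality of a fixing set of $G$; thus $fix(G)=0$ exactly when $G$ is asymmetric. For graphs $G_1$, $G_2$ with $|V(G_1)|=m$, the corona product $G_1\odot G_2$ is the graph obtained by taking one copy of $G_1$ and $m$ disjoint copies of $G_2$, and joining every vertex of the $i$-th copy of $G_2$ by an edge to the $i$-th vertex of $G_1$, for $i=1,\ldots,m$. *)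

theory Defs
  imports "Graph_Theory.Graph_Theory" "HOL-Combinatorics.Permutations"
begin

text \<open>
  A finite simple graph is a \<^locale>\<open>pair_graph\<close>: a finite digraph on ordered pairs, loop-free and
  symmetric, so that an undirected edge uv is the pair of arcs (u, v), (v, u).
\<close>

text \<open>
  Since f permutes the vertex set, it is the identity function outside of it; hence the identity
  automorphism is \<^term>\<open>id\<close> and each automorphism has exactly one representing function.
\<close>

definition graph_automorphism :: "'a pair_pre_digraph \<Rightarrow> ('a \<Rightarrow> 'a) \<Rightarrow> bool" where
  "graph_automorphism G f \<longleftrightarrow> f permutes pverts G \<and>
     (\<forall>u \<in> pverts G. \<forall>v \<in> pverts G. (f u, f v) \<in> parcs G \<longleftrightarrow> (u, v) \<in> parcs G)"

definition asymmetric_graph :: "'a pair_pre_digraph \<Rightarrow> bool" where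
  "asymmetric_graph G \<longleftrightarrow> {f. graph_automorphism G f} = {id}"

definition fixing_set :: "'a pair_pre_digraph \<Rightarrow> 'a set \<Rightarrow> bool" where
  "fixing_set G F \<longleftrightarrow> F \<subseteq> pverts G \<and>
     (\<forall>f. graph_automorphism G f \<and> (\<forall>v \<in> F. f v = v) \<longrightarrow> f = id)"

definition fixing_number :: "'a pair_pre_digraph \<Rightarrow> nat" where
  "fixing_number G = (LEAST k. \<exists>F. fixing_set G F \<and> card F = k)"

text \<open>
  In the corona, \<^term>\<open>Inl i\<close> is the vertex i of the copy of the first graph and
  \<^term>\<open>Inr (i, u)\<close> is the vertex u of the i-th copy of the second graph, the copies being indexed by
  the vertices of the first graph.
\<close>

definition corona :: "'a pair_pre_digraph \<Rightarrow> 'b pair_pre_digraph \<Rightarrow> ('a + 'a \<times> 'b) pair_pre_digraph"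
    (infixl "\<odot>" 70) where
  "G\<^sub>1 \<odot> G\<^sub>2 = \<lparr>
     pverts = Inl ` pverts G\<^sub>1 \<union> Inr ` (pverts G\<^sub>1 \<times> pverts G\<^sub>2),
     parcs = {(Inl i, Inl j) | i j. (i, j) \<in> parcs G\<^sub>1}
       \<union> {(Inr (i, u), Inr (i, v)) | i u v. i \<in> pverts G\<^sub>1 \<and> (u, v) \<in> parcs G\<^sub>2}
       \<union> {(Inl i, Inr (i, u)) | i u. i \<in> pverts G\<^sub>1 \<and> u \<in> pverts G\<^sub>2}
       \<union> {(Inr (i, u), Inl i) | i u. i \<in> pverts G\<^sub>1 \<and> u \<in> pverts G\<^sub>2} \<rparr>"

lemma graph_automorphism_id: "graph_automorphism G id"
  by (auto simp: graph_automorphism_def permutes_id)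

lemma fixing_set_pverts: "fixing_set G (pverts G)"
  by (auto simp: fixing_set_def graph_automorphism_def permutes_def fun_eq_iff)

lemma fixing_number_attained: "\<exists>F. fixing_set G F \<and> card F = fixing_number G"
  unfolding fixing_number_def by (rule LeastI_ex) (use fixing_set_pverts in blast)

lemma fixing_number_le: "fixing_set G F \<Longrightarrow> fixing_number G \<le> card F"
  unfolding fixing_number_def by (rule Least_le) blast

lemma (in pair_graph) fixing_number_eq_0_iff: "fixing_number G = 0 \<longleftrightarrow> asymmetric_graph G"
proof -
  have "fixing_set G {} \<longleftrightarrow> asymmetric_graph G"
    using graph_automorphism_id[of G] by (auto simp: fixing_set_def asymmetric_graph_def)
  moreover have "fixing_number G = 0 \<longleftrightarrow> fixing_set G {}"
  proof
    assume "fixing_number G = 0"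
    then obtain F where F: "fixing_set G F" "card F = 0"
      using fixing_number_attained by metis
    moreover have "finite F"
      using F(1) pair_finite_verts by (auto simp: fixing_set_def intro: finite_subset)
    ultimately show "fixing_set G {}" by simp
  qed (use fixing_number_le in force)
  ultimately show ?thesis by simp
qed

lemma pair_graph_corona:
  assumes "pair_graph G\<^sub>1" and "pair_graph G\<^sub>2"
  shows "pair_graph (G\<^sub>1 \<odot> G\<^sub>2)"
proof -
  interpret G1: pair_graph G\<^sub>1 by fact
  interpret G2: pair_graph G\<^sub>2 by fact
  have wf: "fst e \<in> pverts (G\<^sub>1 \<odot> G\<^sub>2) \<and> snd e \<in> pverts (G\<^sub>1 \<odot> G\<^sub>2)"
    if "e \<in> parcs (G\<^sub>1 \<odot> G\<^sub>2)" for e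
    using that by (auto simp: corona_def dest: G1.wellformed' G2.wellformed')
  have fin: "finite (pverts (G\<^sub>1 \<odot> G\<^sub>2))"
    by (simp add: corona_def)
  have "parcs (G\<^sub>1 \<odot> G\<^sub>2) \<subseteq> pverts (G\<^sub>1 \<odot> G\<^sub>2) \<times> pverts (G\<^sub>1 \<odot> G\<^sub>2)"
    using wf by (auto simp: mem_Times_iff)
  with fin have fina: "finite (parcs (G\<^sub>1 \<odot> G\<^sub>2))"
    by (meson finite_SigmaI finite_subset)
  have "sym (parcs G\<^sub>1)" "sym (parcs G\<^sub>2)"
    using G1.pair_sym_arcs G2.pair_sym_arcs by (simp_all add: symmetric_def)
  then have "sym (parcs (G\<^sub>1 \<odot> G\<^sub>2))"
    by (auto simp: corona_def sym_def)
  moreover have "fst e \<noteq> snd e" if "e \<in> parcs (G\<^sub>1 \<odot> G\<^sub>2)" for e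
    using that by (auto simp: corona_def dest: G1.pair_no_loops G2.pair_no_loops)
  ultimately show ?thesis
    using wf fin fina by unfold_locales (auto simp: symmetric_def)
qed

end

theory Submission
  imports Defs
begin

text \<open>
  In the corona, a vertex of the first graph has degree greater than the order n of the second
  graph, and a vertex of a copy of the second graph has degree at most n, so every automorphism
  preserves the two kinds of vertices. It therefore restricts to an automorphism of the first
  graph and, once it fixes that graph pointwise, to an automorphism of each copy of the second
  graph. Conversely, automorphisms of the first graph and of a single copy extend to the corona.
  Hence a fixing set of the corona meets each copy in a fixing set and projects onto a fixing set
  of the first graph. For equality: if the second graph is asymmetric, a fixing set of the first
  graph suffices; otherwise the union of fixing sets of the copies meets every copy and so already
  fixes the first graph.
\<close>

section \<open>Automorphisms and neighbours in a single graph\<close>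

lemma graph_automorphismI:
  assumes "finite (pverts G)" and "inj_on f (pverts G)" and "f ` pverts G \<subseteq> pverts G"
    and "\<And>x. x \<notin> pverts G \<Longrightarrow> f x = x"
    and "\<And>u v. u \<in> pverts G \<Longrightarrow> v \<in> pverts G \<Longrightarrow> (f u, f v) \<in> parcs G \<longleftrightarrow> (u, v) \<in> parcs G"
  shows "graph_automorphism G f"
proof -
  have "bij_betw f (pverts G) (pverts G)"
    using endo_inj_surj[OF assms(1,3,2)] assms(2) by (simp add: bij_betw_def)
  then show ?thesis
    using assms(4,5) by (simp add: graph_automorphism_def bij_imp_permutes)
qed

text \<open>Here \<open>e\<close> embeds \<open>G\<close> as an induced subgraph of \<open>H\<close>
  whose vertex set \<open>f\<close> maps into itself, so conjugating \<open>f\<close> by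
  \<open>e\<close> gives an automorphism of \<open>G\<close>. It is applied to the base, with
  \<open>e = Inl\<close>, and to each copy.\<close>

lemma graph_automorphism_restrict:
  assumes f: "graph_automorphism H f" and fin: "finite (pverts G)"
    and inj: "inj_on e (pverts G)" and emb: "e ` pverts G \<subseteq> pverts H"
    and arcs: "\<And>u v. u \<in> pverts G \<Longrightarrow> v \<in> pverts G \<Longrightarrow> (e u, e v) \<in> parcs H \<longleftrightarrow> (u, v) \<in> parcs G"
    and invar: "\<And>x. x \<in> pverts G \<Longrightarrow> f (e x) \<in> e ` pverts G"
  shows "\<exists>g. graph_automorphism G g \<and> (\<forall>x\<in>pverts G. e (g x) = f (e x))"
proof (intro exI conjI ballI)
  \<comment> \<open>This is the conjugate of \<open>f\<close> by \<open>e\<close>, extended by the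
    identity because an automorphism must be trivial off the vertex set.\<close>
  define g where "g x = (if x \<in> pverts G then inv_into (pverts G) e (f (e x)) else x)" for x
  show eg: "e (g x) = f (e x)" if "x \<in> pverts G" for x
    using that invar[OF that] by (simp add: g_def f_inv_into_f)
  have g_in: "g x \<in> pverts G" if "x \<in> pverts G" for x
    using that invar[OF that] by (simp add: g_def inv_into_into)
  have injf: "inj f"
    using f by (auto simp: graph_automorphism_def intro: permutes_inj)
  show "graph_automorphism G g"
  proof (rule graph_automorphismI)
    show "inj_on g (pverts G)"
      by (rule inj_onI) (metis eg injD[OF injf] inj_onD[OF inj])
    show "(g u, g v) \<in> parcs G \<longleftrightarrow> (u, v) \<in> parcs G"
      if uv: "u \<in> pverts G" "v \<in> pverts G" for u v
    proof -
      have "(g u, g v) \<in> parcs G \<longleftrightarrow> (f (e u), f (e v)) \<in> parcs H"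
        using uv arcs[of "g u" "g v"] by (simp add: g_in eg)
      also have "\<dots> \<longleftrightarrow> (e u, e v) \<in> parcs H"
        using f emb uv by (auto simp: graph_automorphism_def)
      finally show ?thesis
        using uv arcs by simp
    qed
  qed (use fin g_in in \<open>auto simp: g_def\<close>)
qed

text \<open>Together with injectivity of \<open>f\<close>, this shows that automorphisms preserve
  degrees.\<close>

lemma (in pair_wf_digraph) graph_automorphism_neighbours:
  assumes f: "graph_automorphism G f" and x: "x \<in> pverts G"
  shows "parcs G `` {f x} = f ` (parcs G `` {x})"
proof -
  have p: "f permutes pverts G"
    and arcs: "\<And>u v. u \<in> pverts G \<Longrightarrow> v \<in> pverts G \<Longrightarrow> (f u, f v) \<in> parcs G \<longleftrightarrow> (u, v) \<in> parcs G"
    using f by (auto simp: graph_automorphism_def)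
  show ?thesis
  proof (intro set_eqI iffI)
    fix y assume "y \<in> parcs G `` {f x}"
    then have y: "(f x, y) \<in> parcs G" by simp
    then have "y \<in> f ` pverts G"
      using in_arcsD2 permutes_image[OF p] by simp
    then show "y \<in> f ` (parcs G `` {x})"
      using y arcs[OF x] by auto
  next
    fix y assume "y \<in> f ` (parcs G `` {x})"
    then show "y \<in> parcs G `` {f x}"
      using arcs[OF x] in_arcsD2 by auto
  qed
qed

text \<open>A directed walk from \<open>i\<close> to a different vertex starts with an arc out of
  \<open>i\<close>.\<close>

lemma (in pair_sym_digraph) connected_imp_neighbour:
  assumes con: "connected G" and i: "i \<in> pverts G" and card: "card (pverts G) \<ge> 2"
  obtains j where "(i, j) \<in> parcs G"
proof -
  have "\<not> pverts G \<subseteq> {i}"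
    using card card_mono[of "{i}" "pverts G"] by auto
  then obtain k where k: "k \<in> pverts G" "k \<noteq> i" by blast
  have "strongly_connected G"
    using symmetric_connected_imp_strongly_connected[OF sym_arcs con] .
  then have "i \<rightarrow>\<^sup>*\<^bsub>G\<^esub> k"
    using i k(1) by auto
  then show thesis
    using k(2) that by (cases rule: converse_reachable_cases) auto
qed

section \<open>Adjacency and degrees in the corona\<close>

lemma pverts_corona: "pverts (G\<^sub>1 \<odot> G\<^sub>2) = Inl ` pverts G\<^sub>1 \<union> Inr ` (pverts G\<^sub>1 \<times> pverts G\<^sub>2)"
  by (simp add: corona_def)

lemma parcs_corona_iff:
  "(Inl i, Inl j) \<in> parcs (G\<^sub>1 \<odot> G\<^sub>2) \<longleftrightarrow> (i, j) \<in> parcs G\<^sub>1"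
  "(Inl i, Inr (j, u)) \<in> parcs (G\<^sub>1 \<odot> G\<^sub>2) \<longleftrightarrow> j = i \<and> i \<in> pverts G\<^sub>1 \<and> u \<in> pverts G\<^sub>2"
  "(Inr (j, u), Inl i) \<in> parcs (G\<^sub>1 \<odot> G\<^sub>2) \<longleftrightarrow> j = i \<and> i \<in> pverts G\<^sub>1 \<and> u \<in> pverts G\<^sub>2"
  "(Inr (i, u), Inr (j, v)) \<in> parcs (G\<^sub>1 \<odot> G\<^sub>2) \<longleftrightarrow> j = i \<and> i \<in> pverts G\<^sub>1 \<and> (u, v) \<in> parcs G\<^sub>2"
  by (auto simp: corona_def)

text \<open>This is the form in which connectedness and order at least two of the first graph enter:
  one neighbour in the base lifts the degree of a base vertex above the order of
  \<open>G\<^sub>2\<close>.\<close>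

locale corona_graphs = G1: pair_graph G\<^sub>1 + G2: pair_graph G\<^sub>2
  for G\<^sub>1 :: "'a pair_pre_digraph" and G\<^sub>2 :: "'b pair_pre_digraph" +
  assumes neighbour: "i \<in> pverts G\<^sub>1 \<Longrightarrow> \<exists>j. (i, j) \<in> parcs G\<^sub>1"
begin

sublocale corona: pair_graph "G\<^sub>1 \<odot> G\<^sub>2"
  by (rule pair_graph_corona) unfold_locales

text \<open>The vertex sees its whole copy and at least one further base vertex.\<close>

lemma degree_Inl_gt:
  assumes i: "i \<in> pverts G\<^sub>1"
  shows "card (pverts G\<^sub>2) < card (parcs (G\<^sub>1 \<odot> G\<^sub>2) `` {Inl i})"
proof -
  obtain j where j: "(i, j) \<in> parcs G\<^sub>1"
    using neighbour[OF i] by blast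
  have "insert (Inl j) (Inr ` Pair i ` pverts G\<^sub>2) \<subseteq> parcs (G\<^sub>1 \<odot> G\<^sub>2) `` {Inl i}"
    using i j by (auto simp: parcs_corona_iff)
  moreover have "finite (parcs (G\<^sub>1 \<odot> G\<^sub>2) `` {Inl i})"
    using finite_Image[OF corona.pair_finite_arcs] .
  ultimately have "card (insert (Inl j) (Inr ` Pair i ` pverts G\<^sub>2)) \<le> card (parcs (G\<^sub>1 \<odot> G\<^sub>2) `` {Inl i})"
    by (rule card_mono[rotated])
  moreover have "card (insert (Inl j) (Inr ` Pair i ` pverts G\<^sub>2)) = Suc (card (pverts G\<^sub>2))"
    by (subst card_insert_disjoint) (auto simp: card_image inj_on_def)
  ultimately show ?thesis by simp
qed

text \<open>The only possible neighbours are the base vertex and the other vertices of the same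
  copy.\<close>

lemma degree_Inr_le:
  assumes u: "u \<in> pverts G\<^sub>2"
  shows "card (parcs (G\<^sub>1 \<odot> G\<^sub>2) `` {Inr (i, u)}) \<le> card (pverts G\<^sub>2)"
proof -
  have "parcs (G\<^sub>1 \<odot> G\<^sub>2) `` {Inr (i, u)} \<subseteq> insert (Inl i) (Inr ` Pair i ` (pverts G\<^sub>2 - {u}))"
    using G2.pair_no_loops[of "(u, u)"] by (auto simp: corona_def dest: G2.in_arcsD2)
  then have "card (parcs (G\<^sub>1 \<odot> G\<^sub>2) `` {Inr (i, u)})
      \<le> card (insert (Inl i) (Inr ` Pair i ` (pverts G\<^sub>2 - {u})))"
    by (rule card_mono[rotated]) simp
  also have "\<dots> = Suc (card (pverts G\<^sub>2 - {u}))"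
    by (subst card_insert_disjoint) (auto simp: card_image inj_on_def)
  \<comment> \<open>The absence of a loop at \<open>u\<close> makes up for the additional base
    vertex.\<close>
  also have "\<dots> = card (pverts G\<^sub>2)"
    using u by (simp only: card_Suc_Diff1 G2.pair_finite_verts)
  finally show ?thesis .
qed

lemma range_Inl_iff_degree:
  assumes "x \<in> pverts (G\<^sub>1 \<odot> G\<^sub>2)"
  shows "x \<in> range Inl \<longleftrightarrow> card (pverts G\<^sub>2) < card (parcs (G\<^sub>1 \<odot> G\<^sub>2) `` {x})"
  using assms by (auto simp: pverts_corona degree_Inl_gt degree_Inr_le leD)

section \<open>Automorphisms of the corona\<close>

lemma automorphism_in_pverts_iff:
  "graph_automorphism (G\<^sub>1 \<odot> G\<^sub>2) f \<Longrightarrow> f x \<in> pverts (G\<^sub>1 \<odot> G\<^sub>2) \<longleftrightarrow> x \<in> pverts (G\<^sub>1 \<odot> G\<^sub>2)"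
  unfolding graph_automorphism_def by (auto simp: permutes_in_image)

lemma automorphism_range_Inl_iff:
  assumes f: "graph_automorphism (G\<^sub>1 \<odot> G\<^sub>2) f" and x: "x \<in> pverts (G\<^sub>1 \<odot> G\<^sub>2)"
  shows "f x \<in> range Inl \<longleftrightarrow> x \<in> range Inl"
proof -
  have "inj f"
    using f by (auto simp: graph_automorphism_def intro: permutes_inj)
  then have "card (parcs (G\<^sub>1 \<odot> G\<^sub>2) `` {f x}) = card (parcs (G\<^sub>1 \<odot> G\<^sub>2) `` {x})"
    using corona.graph_automorphism_neighbours[OF f x]
    by (simp add: card_image inj_on_subset)
  then show ?thesis
    using automorphism_in_pverts_iff[OF f] x by (simp add: range_Inl_iff_degree)
qed

lemma automorphism_Inl:
  assumes "graph_automorphism (G\<^sub>1 \<odot> G\<^sub>2) f" and "i \<in> pverts G\<^sub>1"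
  shows "f (Inl i) \<in> Inl ` pverts G\<^sub>1"
  using assms automorphism_range_Inl_iff[of f "Inl i"] automorphism_in_pverts_iff[of f "Inl i"]
  by (auto simp: pverts_corona)

text \<open>The image is adjacent to \<open>Inl j\<close> and is not a base vertex, so it lies in
  the copy attached to \<open>j\<close>.\<close>

lemma automorphism_Inr:
  assumes f: "graph_automorphism (G\<^sub>1 \<odot> G\<^sub>2) f" and i: "i \<in> pverts G\<^sub>1" and u: "u \<in> pverts G\<^sub>2"
    and fi: "f (Inl i) = Inl j"
  shows "f (Inr (i, u)) \<in> (\<lambda>v. Inr (j, v)) ` pverts G\<^sub>2"
proof -
  have V: "Inl i \<in> pverts (G\<^sub>1 \<odot> G\<^sub>2)" "Inr (i, u) \<in> pverts (G\<^sub>1 \<odot> G\<^sub>2)"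
    using i u by (auto simp: pverts_corona)
  have "(f (Inl i), f (Inr (i, u))) \<in> parcs (G\<^sub>1 \<odot> G\<^sub>2)"
    using f V i u by (simp add: graph_automorphism_def parcs_corona_iff)
  moreover have "f (Inr (i, u)) \<notin> range Inl"
    using automorphism_range_Inl_iff[OF f V(2)] by auto
  ultimately show ?thesis
    by (cases "f (Inr (i, u))") (auto simp: fi parcs_corona_iff)
qed

lemma automorphism_restrict_base:
  assumes "graph_automorphism (G\<^sub>1 \<odot> G\<^sub>2) f"
  obtains g where "graph_automorphism G\<^sub>1 g" and "\<And>i. i \<in> pverts G\<^sub>1 \<Longrightarrow> f (Inl i) = Inl (g i)"
proof -
  have "\<exists>g. graph_automorphism G\<^sub>1 g \<and> (\<forall>i\<in>pverts G\<^sub>1. Inl (g i) = f (Inl i))"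
    by (rule graph_automorphism_restrict[OF assms G1.pair_finite_verts])
      (use automorphism_Inl[OF assms] in \<open>auto simp: pverts_corona parcs_corona_iff\<close>)
  then show thesis
    using that by metis
qed

text \<open>Fixing the base vertex \<open>i\<close> keeps its copy invariant, so the restriction
  lemma applies to the embedding of that copy.\<close>

lemma automorphism_restrict_copy:
  assumes "graph_automorphism (G\<^sub>1 \<odot> G\<^sub>2) f" and "i \<in> pverts G\<^sub>1" and "f (Inl i) = Inl i"
  obtains h where "graph_automorphism G\<^sub>2 h" and "\<And>u. u \<in> pverts G\<^sub>2 \<Longrightarrow> f (Inr (i, u)) = Inr (i, h u)"
proof -
  have "\<exists>h. graph_automorphism G\<^sub>2 h \<and> (\<forall>u\<in>pverts G\<^sub>2. Inr (i, h u) = f (Inr (i, u)))"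
  proof (rule graph_automorphism_restrict[OF assms(1) G2.pair_finite_verts])
    show "f (Inr (i, u)) \<in> (\<lambda>u. Inr (i, u)) ` pverts G\<^sub>2" if "u \<in> pverts G\<^sub>2" for u
      using automorphism_Inr[OF assms(1,2) that assms(3)] .
  qed (use assms(2) in \<open>auto simp: pverts_corona parcs_corona_iff inj_on_def\<close>)
  then show thesis
    using that by metis
qed

section \<open>Fixing sets of the corona\<close>

lemma fixing_set_coronaI:
  assumes F: "F \<subseteq> pverts (G\<^sub>1 \<odot> G\<^sub>2)"
    and base: "\<And>f i. graph_automorphism (G\<^sub>1 \<odot> G\<^sub>2) f \<Longrightarrow> \<forall>x\<in>F. f x = x \<Longrightarrow> i \<in> pverts G\<^sub>1 \<Longrightarrow> f (Inl i) = Inl i"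
    and copies: "\<And>i. i \<in> pverts G\<^sub>1 \<Longrightarrow> fixing_set G\<^sub>2 {u. Inr (i, u) \<in> F}"
  shows "fixing_set (G\<^sub>1 \<odot> G\<^sub>2) F"
  unfolding fixing_set_def
proof (intro conjI allI impI F)
  fix f assume "graph_automorphism (G\<^sub>1 \<odot> G\<^sub>2) f \<and> (\<forall>x\<in>F. f x = x)"
  then have f: "graph_automorphism (G\<^sub>1 \<odot> G\<^sub>2) f" and fix_F: "\<forall>x\<in>F. f x = x" by auto
  \<comment> \<open>By \<open>base\<close>, \<open>f\<close> acts on copy \<open>i\<close> as an
    automorphism \<open>h\<close> of \<open>G\<^sub>2\<close>; since \<open>h\<close> fixes the
    trace of \<open>F\<close> on that copy, it is trivial.\<close>
  have fix_copy: "f (Inr (i, u)) = Inr (i, u)" if i: "i \<in> pverts G\<^sub>1" and u: "u \<in> pverts G\<^sub>2" for i u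
  proof -
    obtain h where h: "graph_automorphism G\<^sub>2 h"
      and fh: "\<And>u. u \<in> pverts G\<^sub>2 \<Longrightarrow> f (Inr (i, u)) = Inr (i, h u)"
      using automorphism_restrict_copy[OF f i base[OF f fix_F i]] by blast
    have "h v = v" if "Inr (i, v) \<in> F" for v
      using that F fh[of v] fix_F by (auto simp: pverts_corona)
    then have "h = id"
      using copies[OF i] h by (auto simp: fixing_set_def)
    then show ?thesis using fh[OF u] by simp
  qed
  show "f = id"
  proof
    fix x show "f x = id x"
    proof (cases "x \<in> pverts (G\<^sub>1 \<odot> G\<^sub>2)")
      case True
      then show ?thesis using base[OF f fix_F] fix_copy by (auto simp: pverts_corona)
    next
      case False
      then show ?thesis using f by (auto simp: graph_automorphism_def permutes_def)
    qed
  qed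
qed

text \<open>An automorphism \<open>h\<close> of copy \<open>i\<close> extends to the corona by the
  identity elsewhere. If \<open>h\<close> fixes the trace of \<open>F\<close>, the extension fixes
  \<open>F\<close>, and so both are trivial.\<close>

lemma fixing_set_copy:
  assumes F: "fixing_set (G\<^sub>1 \<odot> G\<^sub>2) F" and i: "i \<in> pverts G\<^sub>1"
  shows "fixing_set G\<^sub>2 {u. Inr (i, u) \<in> F}"
  unfolding fixing_set_def
proof (intro conjI allI impI)
  show "{u. Inr (i, u) \<in> F} \<subseteq> pverts G\<^sub>2"
    using F by (auto simp: fixing_set_def pverts_corona)
next
  fix h assume "graph_automorphism G\<^sub>2 h \<and> (\<forall>u\<in>{u. Inr (i, u) \<in> F}. h u = u)"
  then have h: "graph_automorphism G\<^sub>2 h" and fix_F: "\<And>u. Inr (i, u) \<in> F \<Longrightarrow> h u = u" by auto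
  have perm: "h permutes pverts G\<^sub>2"
    using h by (simp add: graph_automorphism_def)
  define f :: "'a + 'a \<times> 'b \<Rightarrow> 'a + 'a \<times> 'b"
    where "f = case_sum Inl (\<lambda>(j, u). Inr (j, if j = i then h u else u))"
  have "graph_automorphism (G\<^sub>1 \<odot> G\<^sub>2) f"
  proof (rule graph_automorphismI)
    show "inj_on f (pverts (G\<^sub>1 \<odot> G\<^sub>2))"
      by (auto simp: inj_on_def f_def inj_eq[OF permutes_inj[OF perm]] pverts_corona split: if_splits)
    show "f ` pverts (G\<^sub>1 \<odot> G\<^sub>2) \<subseteq> pverts (G\<^sub>1 \<odot> G\<^sub>2)"
      using permutes_in_image[OF perm] by (auto simp: f_def pverts_corona)
    \<comment> \<open>If \<open>x\<close> is \<open>Inr (i, u)\<close> outside the corona, then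
      \<open>u\<close> is not a vertex of \<open>G\<^sub>2\<close> because \<open>i\<close> is one
      of \<open>G\<^sub>1\<close>, and \<open>h\<close> fixes \<open>u\<close>.\<close>
    show "f x = x" if "x \<notin> pverts (G\<^sub>1 \<odot> G\<^sub>2)" for x
      using that i permutes_not_in[OF perm] by (auto simp: f_def pverts_corona split: sum.split)
    show "(f x, f y) \<in> parcs (G\<^sub>1 \<odot> G\<^sub>2) \<longleftrightarrow> (x, y) \<in> parcs (G\<^sub>1 \<odot> G\<^sub>2)"
      if "x \<in> pverts (G\<^sub>1 \<odot> G\<^sub>2)" "y \<in> pverts (G\<^sub>1 \<odot> G\<^sub>2)" for x y
      using that h permutes_in_image[OF perm]
      by (auto simp: f_def pverts_corona parcs_corona_iff graph_automorphism_def split: if_splits)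
  qed (rule corona.pair_finite_verts)
  moreover have "f x = x" if "x \<in> F" for x
    using that fix_F by (auto simp: f_def split: sum.split)
  ultimately have "f = id"
    using F unfolding fixing_set_def by blast
  then have "f (Inr (i, u)) = Inr (i, u)" for u by simp
  then show "h = id"
    by (simp add: f_def fun_eq_iff)
qed

text \<open>The map \<open>case_sum id fst\<close> sends a base vertex to itself and a copy vertex
  to the base vertex it hangs from. An automorphism \<open>g\<close> of the base lifts by carrying
  each copy along unchanged, and the lift fixes \<open>F\<close> if \<open>g\<close> fixes the
  projection of \<open>F\<close>.\<close>

lemma fixing_set_base:
  assumes F: "fixing_set (G\<^sub>1 \<odot> G\<^sub>2) F"
  shows "fixing_set G\<^sub>1 (case_sum id fst ` F)"
  unfolding fixing_set_def
proof (intro conjI allI impI)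
  show "case_sum id fst ` F \<subseteq> pverts G\<^sub>1"
    using F by (auto simp: fixing_set_def pverts_corona)
next
  fix g assume "graph_automorphism G\<^sub>1 g \<and> (\<forall>i\<in>case_sum id fst ` F. g i = i)"
  then have g: "graph_automorphism G\<^sub>1 g" and fix_F: "\<And>x. x \<in> F \<Longrightarrow> g (case_sum id fst x) = case_sum id fst x"
    by auto
  have perm: "g permutes pverts G\<^sub>1"
    using g by (simp add: graph_automorphism_def)
  \<comment> \<open>The case distinction makes the map the identity off the vertex set of the corona.\<close>
  define f :: "'a + 'a \<times> 'b \<Rightarrow> 'a + 'a \<times> 'b"
    where "f = case_sum (\<lambda>i. Inl (g i)) (\<lambda>(i, u). Inr (if u \<in> pverts G\<^sub>2 then g i else i, u))"
  have "graph_automorphism (G\<^sub>1 \<odot> G\<^sub>2) f"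
  proof (rule graph_automorphismI)
    show "inj_on f (pverts (G\<^sub>1 \<odot> G\<^sub>2))"
      by (auto simp: inj_on_def f_def inj_eq[OF permutes_inj[OF perm]] pverts_corona)
    show "f ` pverts (G\<^sub>1 \<odot> G\<^sub>2) \<subseteq> pverts (G\<^sub>1 \<odot> G\<^sub>2)"
      using permutes_in_image[OF perm] by (auto simp: f_def pverts_corona)
    show "f x = x" if "x \<notin> pverts (G\<^sub>1 \<odot> G\<^sub>2)" for x
      using that permutes_not_in[OF perm] by (auto simp: f_def pverts_corona split: sum.split)
    show "(f x, f y) \<in> parcs (G\<^sub>1 \<odot> G\<^sub>2) \<longleftrightarrow> (x, y) \<in> parcs (G\<^sub>1 \<odot> G\<^sub>2)"
      if "x \<in> pverts (G\<^sub>1 \<odot> G\<^sub>2)" "y \<in> pverts (G\<^sub>1 \<odot> G\<^sub>2)" for x y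
      using that g permutes_in_image[OF perm] inj_eq[OF permutes_inj[OF perm]]
      by (auto simp: f_def pverts_corona parcs_corona_iff graph_automorphism_def)
  qed (rule corona.pair_finite_verts)
  moreover have "f x = x" if "x \<in> F" for x
    using fix_F[OF that] by (auto simp: f_def split: sum.splits)
  ultimately have "f = id"
    using F unfolding fixing_set_def by blast
  then have "f (Inl i) = Inl i" for i by simp
  then show "g = id"
    by (simp add: f_def fun_eq_iff)
qed

section \<open>Lower and upper bounds for the fixing number\<close>

lemma fixing_number_base_le: "fixing_number G\<^sub>1 \<le> fixing_number (G\<^sub>1 \<odot> G\<^sub>2)"
proof -
  obtain F where F: "fixing_set (G\<^sub>1 \<odot> G\<^sub>2) F" "card F = fixing_number (G\<^sub>1 \<odot> G\<^sub>2)"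
    using fixing_number_attained by blast
  then have "finite F"
    using corona.pair_finite_verts by (auto simp: fixing_set_def intro: finite_subset)
  then show ?thesis
    using fixing_number_le[OF fixing_set_base[OF F(1)]] card_image_le F(2) by (metis le_trans)
qed

lemma fixing_number_copies_le: "card (pverts G\<^sub>1) * fixing_number G\<^sub>2 \<le> fixing_number (G\<^sub>1 \<odot> G\<^sub>2)"
proof -
  obtain F where F: "fixing_set (G\<^sub>1 \<odot> G\<^sub>2) F" "card F = fixing_number (G\<^sub>1 \<odot> G\<^sub>2)"
    using fixing_number_attained by blast
  then have fin: "finite F"
    using corona.pair_finite_verts by (auto simp: fixing_set_def intro: finite_subset)
  let ?T = "\<lambda>i. {u. Inr (i, u) \<in> F}"
  have finT: "finite (?T i)" if "i \<in> pverts G\<^sub>1" for i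
    using fixing_set_copy[OF F(1) that] G2.pair_finite_verts
    by (auto simp: fixing_set_def intro: finite_subset)
  have "card (pverts G\<^sub>1) * fixing_number G\<^sub>2 \<le> (\<Sum>i\<in>pverts G\<^sub>1. card (?T i))"
    using sum_bounded_below[of "pverts G\<^sub>1" "fixing_number G\<^sub>2"]
      fixing_number_le[OF fixing_set_copy[OF F(1)]] by simp
  \<comment> \<open>Traces on different copies are disjoint, so their sizes add up to the number of
    copy vertices in \<open>F\<close> over the base.\<close>
  also have "\<dots> = card (Inr ` Sigma (pverts G\<^sub>1) ?T :: ('a + 'a \<times> 'b) set)"
    using finT by (simp add: card_image)
  also have "\<dots> \<le> card F"
    using fin by (intro card_mono) auto
  finally show ?thesis
    using F(2) by simp
qed

text \<open>The set \<open>F\<close> forces the base to be fixed, after which each copy admits the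
  trivial automorphism alone.\<close>

lemma fixing_set_corona_asymmetric:
  assumes F: "fixing_set G\<^sub>1 F" and asym: "fixing_set G\<^sub>2 {}"
  shows "fixing_set (G\<^sub>1 \<odot> G\<^sub>2) (Inl ` F)"
proof (rule fixing_set_coronaI)
  show "Inl ` F \<subseteq> pverts (G\<^sub>1 \<odot> G\<^sub>2)"
    using F by (auto simp: fixing_set_def pverts_corona)
next
  fix f i
  assume f: "graph_automorphism (G\<^sub>1 \<odot> G\<^sub>2) f" and fix_F: "\<forall>x\<in>Inl ` F. f x = x" and i: "i \<in> pverts G\<^sub>1"
  obtain g where g: "graph_automorphism G\<^sub>1 g" and fg: "\<And>i. i \<in> pverts G\<^sub>1 \<Longrightarrow> f (Inl i) = Inl (g i)"
    using automorphism_restrict_base[OF f] by blast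
  have "g j = j" if "j \<in> F" for j
    using that F fix_F fg[of j] by (auto simp: fixing_set_def)
  then have "g = id"
    using F g by (auto simp: fixing_set_def)
  then show "f (Inl i) = Inl i"
    using fg[OF i] by simp
qed (use asym in \<open>simp add: image_iff\<close>)

text \<open>A fixed vertex in copy \<open>i\<close> pins \<open>Inl i\<close>: if
  \<open>Inl i\<close> went to \<open>Inl j\<close>, copy \<open>i\<close> would land in copy
  \<open>j\<close>, which forces \<open>j = i\<close>. Hence no base vertex has to be
  chosen.\<close>

lemma fixing_set_corona_copies:
  assumes F: "fixing_set G\<^sub>2 F" and ne: "F \<noteq> {}"
  shows "fixing_set (G\<^sub>1 \<odot> G\<^sub>2) (Inr ` (pverts G\<^sub>1 \<times> F))"
proof (rule fixing_set_coronaI)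
  show "Inr ` (pverts G\<^sub>1 \<times> F) \<subseteq> pverts (G\<^sub>1 \<odot> G\<^sub>2)"
    using F by (auto simp: fixing_set_def pverts_corona)
next
  fix f i
  assume f: "graph_automorphism (G\<^sub>1 \<odot> G\<^sub>2) f"
    and fix_F: "\<forall>x\<in>Inr ` (pverts G\<^sub>1 \<times> F). f x = x" and i: "i \<in> pverts G\<^sub>1"
  obtain u where u: "u \<in> F" using ne by blast
  then have "u \<in> pverts G\<^sub>2" using F by (auto simp: fixing_set_def)
  moreover obtain j where j: "f (Inl i) = Inl j"
    using automorphism_Inl[OF f i] by blast
  ultimately have "f (Inr (i, u)) \<in> (\<lambda>v. Inr (j, v)) ` pverts G\<^sub>2"
    using automorphism_Inr[OF f i] by blast
  moreover have "f (Inr (i, u)) = Inr (i, u)"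
    using fix_F i u by blast
  ultimately show "f (Inl i) = Inl i"
    using j by auto
next
  fix i assume "i \<in> pverts G\<^sub>1"
  then show "fixing_set G\<^sub>2 {u. Inr (i, u) \<in> (Inr ` (pverts G\<^sub>1 \<times> F) :: ('a + 'a \<times> 'b) set)}"
    using F by (simp add: image_iff)
qed

lemma fixing_number_corona_le:
  "fixing_number (G\<^sub>1 \<odot> G\<^sub>2) \<le> max (fixing_number G\<^sub>1) (card (pverts G\<^sub>1) * fixing_number G\<^sub>2)"
proof -
  obtain F\<^sub>1 where F1: "fixing_set G\<^sub>1 F\<^sub>1" "card F\<^sub>1 = fixing_number G\<^sub>1"
    using fixing_number_attained by blast
  obtain F\<^sub>2 where F2: "fixing_set G\<^sub>2 F\<^sub>2" "card F\<^sub>2 = fixing_number G\<^sub>2"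
    using fixing_number_attained by blast
  show ?thesis
  \<comment> \<open>An empty \<open>F\<^sub>2\<close> makes the second term of the maximum zero and
    the first bounds the fixing number; otherwise the second term bounds it.\<close>
  proof (cases "F\<^sub>2 = {}")
    case True
    then show ?thesis
      using fixing_number_le[OF fixing_set_corona_asymmetric[OF F1(1)]] F1(2) F2
      by (simp add: card_image)
  next
    case False
    have "card (Inr ` (pverts G\<^sub>1 \<times> F\<^sub>2) :: ('a + 'a \<times> 'b) set) = card (pverts G\<^sub>1) * fixing_number G\<^sub>2"
      using F2(2) by (simp add: card_image card_cartesian_product)
    then show ?thesis
      using fixing_number_le[OF fixing_set_corona_copies[OF F2(1) False]] by simp
  qed
qed

end

theorem theorem3p10:
  fixes G\<^sub>1 :: "'a pair_pre_digraph" and G\<^sub>2 :: "'b pair_pre_digraph" and m n :: nat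
  assumes "pair_graph G\<^sub>1" and "pair_graph G\<^sub>2"
    and "connected G\<^sub>1"
    and "card (pverts G\<^sub>1) = m" and "card (pverts G\<^sub>2) = n"
    and "m \<ge> 2" and "n \<ge> 2"
  shows "fixing_number (G\<^sub>1 \<odot> G\<^sub>2) = max (fixing_number G\<^sub>1) (m * fixing_number G\<^sub>2)"
proof -
  interpret G1: pair_graph G\<^sub>1 by fact
  interpret G2: pair_graph G\<^sub>2 by fact
  interpret corona_graphs G\<^sub>1 G\<^sub>2
  proof
    fix i assume "i \<in> pverts G\<^sub>1"
    then show "\<exists>j. (i, j) \<in> parcs G\<^sub>1"
      using G1.connected_imp_neighbour assms(3,4,6) by metis
  qed
  show ?thesis
    using fixing_number_corona_le fixing_number_base_le fixing_number_copies_le assms(4)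
    by (intro antisym) auto
qed

end
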